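(* If $P$ is any pointwise c.e. traceable problem, then $\mathrm{Ind}\,\mathbb{Q}_2\not\le_W P$.
   Context: A problem is a partial multivalued function $P\colon\subseteq\mathbb{N}^\mathbb{N}\rightrightarrows\mathbb{N}^\mathbb{N}$. $P\le_W Q$ means there are Turing functionals $\Delta,\Psi$ with $\Delta^p\in\mathrm{dom}\,Q$ for all $p\in\mathrm{dom}\,P$ and $\Psi^{p\oplus q}\in P(p)$ for all $q\in Q(\Delta^p)$; $\equiv_W$ means reducibility in both directions. A problem is first-order if its codomain is $\mathbb{N}$. A problem $P$ is pointwise c.e. traceable if $P\equiv_W Q$ for some first-order problem $Q$ for which there is a Turing functional $\Gamma$ such that for every $q\in\mathrm{dom}\,Q$, $\Gamma^q(0)$ converges to an index $e$ with $W^q_e$ finite and $Q(q)\cap W^q_e\neq\emptyset$ (here $W^q_e$ is the $e$-th set c.e. in $q$). $\mathrm{Ind}\,\mathbb{Q}_2$: instances are pairs $\langle\mathcal{A},c\rangle$ with $\mathcal{A}$ a presentation of the linear order $\mathbb{Q}$ and $c\colon\mathrm{dom}\,\mathcal{A}\to\{0,1\}$; solutions are $c$-monochromatic sets whose induced suborder is isomorphic to $\mathbb{Q}$. *)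

theory Defs
  imports Complex_Main "HOL-Library.Nat_Bijection" "HOL-Library.FuncSet"
begin

section \<open>Oracle computation\<close>

type_synonym baire = "nat \<Rightarrow> nat"

text \<open>
  Programs for the unary partial recursive functions relative to an oracle; functions of several
  arguments are treated as unary functions by means of the pairing function prod_encode.
\<close>

datatype prog =
    Zero
  | Succ
  | First
  | Second
  | Oracle
  | Pairing prog prog
  | Comp prog prog
  | PrimRec prog prog
  | Mu prog

text \<open>
  \<open>computes p f x y\<close>: program \<open>f\<close> with oracle \<open>p\<close> halts on input \<open>x\<close> with output \<open>y\<close>.
  Primitive recursion is on the second component of the input. \<open>Mu f\<close> returns the least zero of
  \<open>f\<close> in the second component, provided that \<open>f\<close> converges on all smaller values.
\<close>

inductive computes :: "baire \<Rightarrow> prog \<Rightarrow> nat \<Rightarrow> nat \<Rightarrow> bool" for p :: baire where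
  Zero: "computes p Zero x 0"
| Succ: "computes p Succ x (Suc x)"
| First: "computes p First (prod_encode (x, y)) x"
| Second: "computes p Second (prod_encode (x, y)) y"
| Oracle: "computes p Oracle x (p x)"
| Pairing: "computes p f x y \<Longrightarrow> computes p g x z \<Longrightarrow> computes p (Pairing f g) x (prod_encode (y, z))"
| Comp: "computes p g x y \<Longrightarrow> computes p f y z \<Longrightarrow> computes p (Comp f g) x z"
| PrimRec_0: "computes p f x y \<Longrightarrow> computes p (PrimRec f g) (prod_encode (x, 0)) y"
| PrimRec_Suc: "computes p (PrimRec f g) (prod_encode (x, n)) y \<Longrightarrow>
    computes p g (prod_encode (x, prod_encode (n, y))) z \<Longrightarrow>
    computes p (PrimRec f g) (prod_encode (x, Suc n)) z"
| Mu: "computes p f (prod_encode (x, n)) 0 \<Longrightarrow>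
    (\<forall>m<n. \<exists>y. computes p f (prod_encode (x, m)) (Suc y)) \<Longrightarrow>
    computes p (Mu f) x n"

lemma computes_deterministic:
  assumes "computes p f x y" and "computes p f x z"
  shows "y = z"
  using assms
proof (induction arbitrary: z rule: computes.induct)
  case (Pairing f x y g z')
  from Pairing.prems show ?case
    by cases (use Pairing.IH in auto)
next
  case (Comp g x y f z')
  from Comp.prems show ?case
    by cases (use Comp.IH in auto)
next
  case (PrimRec_0 f x y g)
  from PrimRec_0.prems show ?case
    by cases (use PrimRec_0.IH in auto)
next
  case (PrimRec_Suc f g x n y z')
  from PrimRec_Suc.prems show ?case
    by cases (use PrimRec_Suc.IH in auto)
next
  case (Mu f x n)
  from Mu.prems show ?case
  proof cases
    case Mu': Mu
    show ?thesis
    proof (rule linorder_cases[of n z])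
      assume "n < z"
      then obtain y where "computes p f (prod_encode (x, n)) (Suc y)"
        using Mu' by blast
      then show ?thesis using Mu.IH(1) by blast
    next
      assume "z < n"
      then show ?thesis using Mu.IH(2) Mu' by blast
    qed
  qed
qed (auto elim: computes.cases)

text \<open>An effective numbering of programs, in which every natural number is an index.\<close>

primrec index :: "prog \<Rightarrow> nat" where
  "index Zero = 0"
| "index Succ = 1"
| "index First = 2"
| "index Second = 3"
| "index Oracle = 4"
| "index (Pairing f g) = 5 + 4 * prod_encode (index f, index g)"
| "index (Comp f g) = 6 + 4 * prod_encode (index f, index g)"
| "index (PrimRec f g) = 7 + 4 * prod_encode (index f, index g)"
| "index (Mu f) = 8 + 4 * index f"

lemma index_surj: "\<exists>f. index f = e"
proof (induction e rule: less_induct)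
  case (less e)
  show ?case
  proof (cases "e \<le> 4")
    case True
    then have "e \<in> {0, 1, 2, 3, 4}" by auto
    then show ?thesis
      using index.simps(1-5) by (metis empty_iff insert_iff)
  next
    case False
    define k where "k = (e - 5) div 4"
    have e: "e \<in> {5 + 4 * k, 6 + 4 * k, 7 + 4 * k, 8 + 4 * k}"
      using False unfolding k_def by (simp, presburger)
    obtain a b where k: "k = prod_encode (a, b)" by (metis prod.collapse prod_decode_inverse)
    have "k < e" using e by auto
    moreover have "a \<le> k" "b \<le> k"
      unfolding k by (simp_all add: le_prod_encode_1 le_prod_encode_2)
    ultimately obtain f g h where "index f = a" "index g = b" "index h = k"
      using less by (meson le_less_trans)
    then show ?thesis
      using e k index.simps(6)[of f g] index.simps(7)[of f g] index.simps(8)[of f g]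
        index.simps(9)[of h] by (metis empty_iff insert_iff)
  qed
qed

lemma index_inj: "index f = index g \<Longrightarrow> f = g"
proof (induction f arbitrary: g)
  case (Pairing f1 f2)
  then show ?case by (cases g; simp; presburger)
next
  case (Comp f1 f2)
  then show ?case by (cases g; simp; presburger)
next
  case (PrimRec f1 f2)
  then show ?case by (cases g; simp; presburger)
next
  case (Mu f)
  then show ?case by (cases g; simp; presburger)
qed (case_tac [!] g, auto)

text \<open>\<open>W q e\<close> is the \<open>e\<close>-th set c.e. in \<open>q\<close>: the domain of the \<open>e\<close>-th program with oracle \<open>q\<close>.\<close>

definition W :: "baire \<Rightarrow> nat \<Rightarrow> nat set" where
  "W q e = {x. \<exists>f y. index f = e \<and> computes q f x y}"

text \<open>
  \<open>functional_value f p q\<close>: the Turing functional given by \<open>f\<close> is total on the oracle \<open>p\<close>,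
  and its value there is \<open>q\<close>.
\<close>

definition functional_value :: "prog \<Rightarrow> baire \<Rightarrow> baire \<Rightarrow> bool" where
  "functional_value f p q \<longleftrightarrow> (\<forall>n. computes p f n (q n))"

definition join :: "baire \<Rightarrow> baire \<Rightarrow> baire" (infixr "\<oplus>" 65) where
  "p \<oplus> q = (\<lambda>n. if even n then p (n div 2) else q (n div 2))"


section \<open>Problems and Weihrauch reducibility\<close>

text \<open>A partial multivalued function is given by its set of values, which is empty off the domain.\<close>

type_synonym problem = "baire \<Rightarrow> baire set"

definition pdom :: "('a \<Rightarrow> 'b set) \<Rightarrow> 'a set" where
  "pdom P = {p. P p \<noteq> {}}"

definition weihrauch_le :: "problem \<Rightarrow> problem \<Rightarrow> bool" (infix "\<le>\<^sub>W" 50) where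
  "P \<le>\<^sub>W Q \<longleftrightarrow> (\<exists>\<Delta> \<Psi>. \<forall>p \<in> pdom P. \<exists>r. functional_value \<Delta> p r \<and> r \<in> pdom Q \<and>
     (\<forall>q \<in> Q r. \<exists>s. functional_value \<Psi> (p \<oplus> q) s \<and> s \<in> P p))"

definition weihrauch_equiv :: "problem \<Rightarrow> problem \<Rightarrow> bool" (infix "\<equiv>\<^sub>W" 50) where
  "P \<equiv>\<^sub>W Q \<longleftrightarrow> P \<le>\<^sub>W Q \<and> Q \<le>\<^sub>W P"

text \<open>
  First-order problems have codomain \<open>nat\<close>. They are regarded as problems by identifying a
  number with the constant sequence of that value.
\<close>

type_synonym first_order_problem = "baire \<Rightarrow> nat set"

definition as_problem :: "first_order_problem \<Rightarrow> problem" where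
  "as_problem Q = (\<lambda>q. (\<lambda>n _. n) ` Q q)"

definition pointwise_ce_traceable :: "problem \<Rightarrow> bool" where
  "pointwise_ce_traceable P \<longleftrightarrow> (\<exists>Q :: first_order_problem. P \<equiv>\<^sub>W as_problem Q \<and>
     (\<exists>\<Gamma>. \<forall>q \<in> pdom Q. \<exists>e. computes q \<Gamma> 0 e \<and> finite (W q e) \<and> Q q \<inter> W q e \<noteq> {}))"


section \<open>Indivisibility of the rationals for two colours\<close>

definition iso_rat :: "nat set \<Rightarrow> nat rel \<Rightarrow> bool" where
  "iso_rat A R \<longleftrightarrow> (\<exists>f :: nat \<Rightarrow> rat. bij_betw f A UNIV \<and>
     (\<forall>x \<in> A. \<forall>y \<in> A. (x, y) \<in> R \<longleftrightarrow> f x < f y))"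

text \<open>A presentation of the strict linear order of the rationals, with domain a set of numbers.\<close>

definition rat_presentation :: "nat set \<Rightarrow> nat rel \<Rightarrow> bool" where
  "rat_presentation A R \<longleftrightarrow> R \<subseteq> A \<times> A \<and> iso_rat A R"

definition char_fun :: "nat set \<Rightarrow> baire" where
  "char_fun A = (\<lambda>n. of_bool (n \<in> A))"

text \<open>
  The colouring is a function on \<open>A\<close> only, so its values off \<open>A\<close> are replaced by 0 in the code.
\<close>

definition instance_code :: "nat set \<Rightarrow> nat rel \<Rightarrow> (nat \<Rightarrow> nat) \<Rightarrow> baire" where
  "instance_code A R c =
     (char_fun A \<oplus> char_fun (prod_encode ` R)) \<oplus> (\<lambda>n. if n \<in> A then c n else 0)"

text \<open>
  Since the rationals are indivisible, every instance has a solution, so the domain of the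
  following problem consists of exactly the codes of instances.
\<close>

definition Ind_Q2 :: problem where
  "Ind_Q2 p = {char_fun H | H A R c.
     p = instance_code A R c \<and> rat_presentation A R \<and> c \<in> A \<rightarrow> {0, 1} \<and>
     H \<subseteq> A \<and> (\<exists>i. \<forall>x \<in> H. c x = i) \<and> iso_rat H (R \<inter> H \<times> H)}"

end

theory Submission
  imports Defs "HOL-Library.Countable_Set"
begin

text \<open>
  A reduction of \<open>Ind_Q2\<close> to a traceable problem assigns to each colouring \<open>c\<close> of a fixed copy of the
  rationals a finite set \<open>T c\<close>, enumerated continuously in \<open>c\<close>, and for each \<open>n\<close> a continuously
  enumerated set \<open>S c n\<close>, such that \<open>S c n\<close> is a solution for some \<open>n \<in> T c\<close>. Since \<open>T c\<close> is always
  finite, \<open>T\<close> is constant on some cylinder, with value \<open>F\<close>. Shrink the cylinder so that as many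
  \<open>n \<in> F\<close> as possible have more than \<open>card F\<close> elements in \<open>S c n\<close>; for the other \<open>n\<close>, the set \<open>S c n\<close> is then
  finite on the whole cylinder. The former \<open>n\<close> admit pairwise disjoint intervals with end points
  in \<open>S c n\<close>, and all but finitely many points of such an interval can be given the colour
  opposite to that of the left end point. So \<open>S c n\<close> is not a monochromatic dense order, for any \<open>n \<in> F\<close>.
\<close>

section \<open>Finite use\<close>

definition agree :: "nat \<Rightarrow> (nat \<Rightarrow> 'a) \<Rightarrow> (nat \<Rightarrow> 'a) \<Rightarrow> bool" where
  "agree m p q \<longleftrightarrow> (\<forall>i<m. p i = q i)"

lemma agree_refl [simp]: "agree m p p"
  by (simp add: agree_def)

lemma agree_trans: "agree m p q \<Longrightarrow> agree m q r \<Longrightarrow> agree m p r"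
  by (simp add: agree_def)

lemma agree_mono: "agree m p q \<Longrightarrow> k \<le> m \<Longrightarrow> agree k p q"
  by (simp add: agree_def)

lemma agree_join:
  assumes "agree m p p'" and "agree m q q'"
  shows "agree m (p \<oplus> q) (p' \<oplus> q')"
  unfolding agree_def
proof (intro allI impI)
  fix i assume "i < m"
  then have "i div 2 < m" by (meson div_le_dividend le_less_trans)
  then show "(p \<oplus> q) i = (p' \<oplus> q') i"
    using assms by (simp add: agree_def join_def)
qed

text \<open>Openness of a predicate on sequences, for the product of the discrete topologies.\<close>

definition finitary :: "((nat \<Rightarrow> 'a) \<Rightarrow> bool) \<Rightarrow> bool" where
  "finitary \<phi> \<longleftrightarrow> (\<forall>p. \<phi> p \<longrightarrow> (\<exists>m. \<forall>q. agree m p q \<longrightarrow> \<phi> q))"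

lemma finitaryD: "finitary \<phi> \<Longrightarrow> \<phi> p \<Longrightarrow> \<exists>m. \<forall>q. agree m p q \<longrightarrow> \<phi> q"
  by (simp add: finitary_def)

lemma finitary_const: "finitary (\<lambda>_. a)"
  by (simp add: finitary_def)

lemma finitary_nth: "finitary (\<lambda>p. \<phi> (p i))"
  unfolding finitary_def agree_def by (metis lessI)

lemma cylinder_conj:
  assumes "\<exists>m. \<forall>q. agree m p q \<longrightarrow> \<phi> q" and "\<exists>m. \<forall>q. agree m p q \<longrightarrow> \<psi> q"
  shows "\<exists>m. \<forall>q. agree m p q \<longrightarrow> \<phi> q \<and> \<psi> q"
proof -
  obtain m k where mk: "\<forall>q. agree m p q \<longrightarrow> \<phi> q" "\<forall>q. agree k p q \<longrightarrow> \<psi> q"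
    using assms by auto
  have "\<phi> q \<and> \<psi> q" if "agree (max m k) p q" for q
    using mk agree_mono[OF that, of m] agree_mono[OF that, of k] by simp
  then show ?thesis by auto
qed

lemma finitary_conj:
  assumes "finitary \<phi>" and "finitary \<psi>"
  shows "finitary (\<lambda>p. \<phi> p \<and> \<psi> p)"
  using assms unfolding finitary_def by (simp add: cylinder_conj)

lemma finitary_ball:
  assumes "finite I" and "\<And>i. i \<in> I \<Longrightarrow> finitary (\<phi> i)"
  shows "finitary (\<lambda>p. \<forall>i\<in>I. \<phi> i p)"
  using assms by (induction I) (simp_all add: finitary_const finitary_conj)

lemma finitary_ex:
  assumes "\<And>i. finitary (\<phi> i)"
  shows "finitary (\<lambda>p. \<exists>i. \<phi> i p)"
  using assms unfolding finitary_def by fast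

text \<open>Openness holds for arbitrary \<open>\<phi>\<close>, since the quantified cylinder
  depends only on the first \<open>m\<close> values of \<open>p\<close>.\<close>

lemma finitary_cylinder: "finitary (\<lambda>p. \<forall>q. agree m p q \<longrightarrow> \<phi> q)"
  unfolding finitary_def using agree_trans by fast

text \<open>The use principle: a halting derivation is finite and so queries the oracle at only
  finitely many places.\<close>

lemma finitary_computes: "finitary (\<lambda>p. computes p f x y)"
  unfolding finitary_def
proof (intro allI impI)
  fix p assume "computes p f x y"
  then show "\<exists>m. \<forall>q. agree m p q \<longrightarrow> computes q f x y"
  proof induction
    case (Oracle x)
    show ?case
      by (rule exI[of _ "Suc x"]) (metis agree_def computes.Oracle lessI)
  next
    case (Pairing f x y g z)
    from cylinder_conj[OF Pairing.IH] show ?case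
      by (auto intro: computes.Pairing)
  next
    case (Comp g x y f z)
    from cylinder_conj[OF Comp.IH] show ?case
      by (auto intro: computes.Comp)
  next
    case (PrimRec_0 f x y g)
    then show ?case by (auto intro: computes.PrimRec_0)
  next
    case (PrimRec_Suc f g x n y z)
    from cylinder_conj[OF PrimRec_Suc.IH] show ?case
      by (auto intro: computes.PrimRec_Suc)
  next
    case (Mu f x n)
    then obtain m where m: "\<forall>q. agree m p q \<longrightarrow> computes q f (prod_encode (x, n)) 0" by blast
    from Mu.IH(2) obtain Y K where K: "\<And>i q. i < n \<Longrightarrow> agree (K i) p q \<Longrightarrow>
        computes q f (prod_encode (x, i)) (Suc (Y i))"
      by metis
    \<comment> \<open>Only \<open>n\<close> runs precede the zero, so their moduli have a maximum;
      \<open>insert 0\<close> keeps the set nonempty when \<open>n = 0\<close>.\<close>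
    have "computes q (Mu f) x n" if q: "agree (max m (Max (insert 0 (K ` {..<n})))) p q" for q
    proof (rule computes.Mu)
      show "computes q f (prod_encode (x, n)) 0"
        using m q agree_mono max.cobounded1 by blast
      have "agree (K i) p q" if "i < n" for i
        by (rule agree_mono[OF q]) (simp add: max.coboundedI2 that)
      then show "\<forall>i<n. \<exists>y. computes q f (prod_encode (x, i)) (Suc y)"
        using K by blast
    qed
    then show ?case by blast
  qed (simp_all add: computes.Zero computes.Succ computes.First computes.Second)
qed

text \<open>Continuity for the product topologies: every output coordinate is locally
  constant.\<close>

definition local_map :: "((nat \<Rightarrow> 'a) \<Rightarrow> (nat \<Rightarrow> 'b)) \<Rightarrow> bool" where
  "local_map G \<longleftrightarrow> (\<forall>i v. finitary (\<lambda>p. G p i = v))"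

lemma finitary_local_map:
  assumes "local_map G" and "finitary \<phi>"
  shows "finitary (\<lambda>p. \<phi> (G p))"
  unfolding finitary_def
proof (intro allI impI)
  fix p assume "\<phi> (G p)"
  from finitaryD[OF assms(2), OF this]
  obtain m where m: "\<forall>q. agree m (G p) q \<longrightarrow> \<phi> q" ..
  have "finitary (\<lambda>q. \<forall>i\<in>{..<m}. G q i = G p i)"
    by (rule finitary_ball) (use assms(1) in \<open>simp_all add: local_map_def\<close>)
  from finitaryD[OF this] obtain k
    where k: "\<forall>q. agree k p q \<longrightarrow> (\<forall>i\<in>{..<m}. G q i = G p i)" by blast
  have "\<forall>q. agree k p q \<longrightarrow> agree m (G p) (G q)"
    unfolding agree_def[of m] using k by (metis lessThan_iff)
  then have "\<forall>q. agree k p q \<longrightarrow> \<phi> (G q)" using m by simp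
  then show "\<exists>m. \<forall>q. agree m p q \<longrightarrow> \<phi> (G q)" ..
qed

lemma functional_value_iff:
  assumes "functional_value f p q"
  shows "q i = v \<longleftrightarrow> computes p f i v"
  using assms computes_deterministic unfolding functional_value_def by metis

lemma local_map_functional_value:
  assumes "local_map G" and "\<And>p. functional_value f (G p) (r p)"
  shows "local_map r"
  unfolding local_map_def functional_value_iff[OF assms(2)]
  by (intro allI finitary_local_map[OF assms(1) finitary_computes])

lemma local_map_join_const:
  assumes "local_map G"
  shows "local_map (\<lambda>p. G p \<oplus> (\<lambda>_. n))"
  unfolding local_map_def
proof (intro allI)
  fix i v
  show "finitary (\<lambda>p. (G p \<oplus> (\<lambda>_. n)) i = v)"
    using assms by (cases "even i") (simp_all add: join_def local_map_def finitary_const)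
qed

section \<open>Indivisibility of the rationals\<close>

text \<open>
  The forth half of the back-and-forth construction: a set need not be enumerated exhaustively
  in order to contain a copy of the rationals.
\<close>

lemma dense_embedding:
  fixes f g :: "nat \<Rightarrow> rat"
  assumes "inj f" and "a < b"
    and dense: "\<And>u v. a \<le> u \<Longrightarrow> u < v \<Longrightarrow> v \<le> b \<Longrightarrow> \<exists>d. D d \<and> u < g d \<and> g d < v"
  shows "\<exists>h. (\<forall>n. D (h n)) \<and> (\<forall>i j. f i < f j \<longleftrightarrow> g (h i) < g (h j))"
proof -
  \<comment> \<open>Course-of-values recursion for \<open>h\<close>: the new point \<open>d\<close>
    must fall into the cut that \<open>f n\<close> makes among the points already placed.\<close>
  define Q where "Q h n d \<longleftrightarrow> D d \<and> a < g d \<and> g d < b \<and>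
    (\<forall>i<n. (f i < f n \<longrightarrow> g (h i) < g d) \<and> (f n < f i \<longrightarrow> g d < g (h i)))" for h n d
  have "\<exists>h. \<forall>n. Q h n (h n)"
  proof (rule dependent_wf_choice[OF wf_less_than])
    fix h h' :: "nat \<Rightarrow> nat" and n d
    assume "\<And>i. (i, n) \<in> less_than \<Longrightarrow> h i = h' i"
    then show "Q h n d = Q h' n d" by (simp add: Q_def)
  next
    fix n h assume "\<And>i. (i, n) \<in> less_than \<Longrightarrow> Q h i (h i)"
    then have Q: "Q h i (h i)" if "i < n" for i using that by simp
    have mono: "g (h i) < g (h j)" if "i < n" "j < n" "f i < f j" for i j
      using Q that by (cases i j rule: linorder_cases) (auto simp: Q_def)
    \<comment> \<open>\<open>a\<close> and \<open>b\<close> keep both finite sets nonempty, so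
      density applies between \<open>Max L\<close> and \<open>Min U\<close> even if one side has no
      earlier point.\<close>
    define L where "L = insert a ((\<lambda>i. g (h i)) ` {i. i < n \<and> f i < f n})"
    define U where "U = insert b ((\<lambda>i. g (h i)) ` {i. i < n \<and> f n < f i})"
    have fin: "finite L" "finite U" "L \<noteq> {}" "U \<noteq> {}" by (simp_all add: L_def U_def)
    have "l < u" if "l \<in> L" "u \<in> U" for l u
      using that Q assms(2) mono by (fastforce simp: L_def U_def Q_def)
    then have "Max L < Min U" using fin by simp
    moreover have "a \<le> Max L" "Min U \<le> b" using fin by (simp_all add: L_def U_def)
    ultimately obtain d where "D d" "Max L < g d" "g d < Min U" using dense by blast
    then have "Q h n d" using fin by (auto simp: Q_def L_def U_def)
    then show "\<exists>d. Q h n d" ..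
  qed
  then obtain h where h: "\<And>n. Q h n (h n)" by blast
  have mono: "g (h i) < g (h j)" if "f i < f j" for i j
    using h that by (cases i j rule: linorder_cases) (auto simp: Q_def)
  have "f i < f j \<longleftrightarrow> g (h i) < g (h j)" for i j
  proof (rule linorder_cases[of "f i" "f j"])
    assume "f i = f j"
    then show ?thesis using \<open>inj f\<close> by (simp add: inj_eq)
  qed (use mono in \<open>auto dest: order_less_asym\<close>)
  then show ?thesis using h by (intro exI[of _ h]) (simp add: Q_def)
qed

text \<open>Either the colour \<open>True\<close> is dense between 0 and 1, or some subinterval
  carries only \<open>False\<close>; in both cases \<open>dense_embedding\<close> yields a
  monochromatic copy.\<close>

lemma rat_indivisible:
  fixes f :: "nat \<Rightarrow> rat" and c :: "nat \<Rightarrow> bool"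
  assumes "bij f"
  shows "\<exists>H k. (\<forall>x\<in>H. c x = k) \<and> iso_rat H ({(x, y). f x < f y} \<inter> H \<times> H)"
proof -
  have "\<exists>k h. (\<forall>n. c (h n) = k) \<and> (\<forall>i j. f i < f j \<longleftrightarrow> f (h i) < f (h j))"
  proof (cases "\<forall>u v. (0::rat) \<le> u \<longrightarrow> u < v \<longrightarrow> v \<le> 1 \<longrightarrow> (\<exists>d. c d = True \<and> u < f d \<and> f d < v)")
    case True
    have "\<exists>h. (\<forall>n. c (h n) = True) \<and> (\<forall>i j. f i < f j \<longleftrightarrow> f (h i) < f (h j))"
      by (rule dense_embedding[OF bij_is_inj[OF assms], of 0 1]) (use True in auto)
    then show ?thesis by (intro exI[of _ True])
  next
    case False
    then obtain a b where ab: "a < b" "\<And>d. a < f d \<Longrightarrow> f d < b \<Longrightarrow> c d = False" by auto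
    have "\<exists>d. c d = False \<and> u < f d \<and> f d < v" if "a \<le> u" "u < v" "v \<le> b" for u v
    proof -
      obtain w where w: "u < w" "w < v" using dense \<open>u < v\<close> by blast
      obtain d where "f d = w" using bij_is_surj[OF assms] by (metis surjD)
      then have "c d = False \<and> u < f d \<and> f d < v" using ab(2) that w by simp
      then show ?thesis ..
    qed
    then have "\<exists>h. (\<forall>n. c (h n) = False) \<and> (\<forall>i j. f i < f j \<longleftrightarrow> f (h i) < f (h j))"
      by (rule dense_embedding[OF bij_is_inj[OF assms] ab(1)])
    then show ?thesis by (intro exI[of _ False])
  qed
  then obtain k h where h: "\<And>n. c (h n) = k" "\<And>i j. f i < f j \<longleftrightarrow> f (h i) < f (h j)" by blast
  have "inj h"
  proof (rule injI)
    fix i j assume "h i = h j"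
    then have "\<not> f i < f j" "\<not> f j < f i" by (simp_all only: h(2) less_irrefl not_False_eq_True)
    then show "i = j" using bij_is_inj[OF assms] by (simp add: inj_eq)
  qed
  have "bij_betw (f \<circ> inv h) (range h) UNIV"
    by (rule bij_betw_trans[OF _ assms]) (simp add: \<open>inj h\<close> inj_imp_bij_betw_inv)
  moreover have "\<forall>x\<in>range h. \<forall>y\<in>range h.
      (x, y) \<in> {(x, y). f x < f y} \<inter> range h \<times> range h \<longleftrightarrow> (f \<circ> inv h) x < (f \<circ> inv h) y"
    using \<open>inj h\<close> by (auto simp: h(2)[symmetric])
  ultimately have "iso_rat (range h) ({(x, y). f x < f y} \<inter> range h \<times> range h)"
    unfolding iso_rat_def by blast
  moreover have "\<forall>x\<in>range h. c x = k" using h(1) by blast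
  ultimately show ?thesis by blast
qed

text \<open>The isomorphism is onto all rationals, so every point of a rational interval has a
  preimage in \<open>H\<close>. The adversary violates this consequence of density.\<close>

lemma iso_rat_infinite_interval:
  fixes f :: "nat \<Rightarrow> rat"
  assumes "iso_rat H ({(x, y). f x < f y} \<inter> H \<times> H)" and "x \<in> H" "y \<in> H" "f x < f y"
  shows "infinite {z \<in> H. f x < f z \<and> f z < f y}"
proof -
  obtain g :: "nat \<Rightarrow> rat" where g: "bij_betw g H UNIV"
    and mono: "\<And>x y. x \<in> H \<Longrightarrow> y \<in> H \<Longrightarrow> f x < f y \<longleftrightarrow> g x < g y"
    using assms(1) unfolding iso_rat_def by auto
  have "{g x<..<g y} \<subseteq> g ` {z \<in> H. f x < f z \<and> f z < f y}"
  proof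
    fix w assume w: "w \<in> {g x<..<g y}"
    obtain z where "z \<in> H" "w = g z" using g by (metis UNIV_I bij_betw_imp_surj_on imageE)
    then show "w \<in> g ` {z \<in> H. f x < f z \<and> f z < f y}" using w mono assms(2,3) by auto
  qed
  moreover have "infinite {g x<..<g y}" using mono assms(2-4) by (simp add: infinite_Ioo)
  ultimately show ?thesis by (meson finite_imageI finite_subset)
qed

lemma iso_rat_infinite: "iso_rat H R \<Longrightarrow> infinite H"
  unfolding iso_rat_def using bij_betw_finite infinite_UNIV_char_0 by blast

section \<open>The adversary\<close>

lemma disjoint_intervals:
  fixes X :: "'i \<Rightarrow> 'a::linorder set"
  assumes "finite G" and "\<And>n. n \<in> G \<Longrightarrow> finite (X n) \<and> card G < card (X n)"
  shows "\<exists>x y. (\<forall>n\<in>G. x n \<in> X n \<and> y n \<in> X n \<and> x n < y n) \<and>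
    (\<forall>n\<in>G. \<forall>k\<in>G. n \<noteq> k \<longrightarrow> y n \<le> x k \<or> y k \<le> x n)"
  using assms
proof (induction "card G" arbitrary: G X)
  case 0
  then show ?case by simp
next
  case (Suc l)
  text \<open>The interval between the two least points goes to the set with the smallest second point.\<close>
  define m where "m n = Min (X n)" for n
  define s where "s n = Min (X n - {m n})" for n
  have ne: "finite (X n)" "X n \<noteq> {}" "finite (X n - {m n})" "X n - {m n} \<noteq> {}"
    if "n \<in> G" for n
  proof -
    show fin: "finite (X n)" "finite (X n - {m n})" using Suc.prems(2)[OF that] by auto
    have "1 < card (X n)" using Suc.prems(2)[OF that] Suc.hyps(2) by linarith
    moreover have "card (X n) - card {m n} \<le> card (X n - {m n})"
      by (rule diff_card_le_card_Diff) simp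
    ultimately have "card (X n - {m n}) > 0" by simp
    then show "X n - {m n} \<noteq> {}" by (metis card.empty less_irrefl)
    then show "X n \<noteq> {}" by blast
  qed
  have m: "m n \<in> X n" "\<And>z. z \<in> X n \<Longrightarrow> m n \<le> z" if "n \<in> G" for n
    using ne[OF that] by (simp_all add: m_def)
  have s: "s n \<in> X n" "s n \<noteq> m n" "\<And>z. z \<in> X n \<Longrightarrow> z \<noteq> m n \<Longrightarrow> s n \<le> z" if "n \<in> G" for n
    using Min_in[OF ne(3,4)[OF that]] Min_le[OF ne(3)[OF that]] by (auto simp: s_def)
  have "G \<noteq> {}" using Suc.hyps(2) by auto
  then have "Min (s ` G) \<in> s ` G" using Suc.prems(1) by (intro Min_in) simp_all
  then obtain k where k: "k \<in> G" "s k = Min (s ` G)" by auto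
  then have least: "s k \<le> s n" if "n \<in> G" for n using Suc.prems(1) that by simp
  \<comment> \<open>Since \<open>s k \<le> s n\<close>, discarding the points below
    \<open>s k\<close> costs another set at most its least point, while \<open>G\<close> also loses
    one member. Later intervals then start at or above \<open>s k\<close>.\<close>
  define X' where "X' n = {z \<in> X n. s k \<le> z}" for n
  have "finite (X' n) \<and> card (G - {k}) < card (X' n)" if "n \<in> G - {k}" for n
  proof -
    from that have n: "n \<in> G" by simp
    have fin: "finite (X' n)" using ne(1)[OF n] by (simp add: X'_def)
    have "X n - {m n} \<subseteq> X' n"
      using s(3)[OF n] order_trans[OF least[OF n]] by (auto simp: X'_def)
    then have "card (X n - {m n}) \<le> card (X' n)" by (rule card_mono[OF fin])
    then have "card (X n) - 1 \<le> card (X' n)" using m(1)[OF n] by (simp add: card_Diff_singleton)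
    then show ?thesis
      using fin Suc.prems(2)[OF n] Suc.hyps(2) k(1) by (auto simp: card_Diff_singleton)
  qed
  moreover have "l = card (G - {k})" using Suc.hyps(2) k(1) by (simp add: card_Diff_singleton)
  ultimately obtain x y where
    xy: "\<forall>n\<in>G - {k}. x n \<in> X' n \<and> y n \<in> X' n \<and> x n < y n"
    and disj: "\<forall>n\<in>G - {k}. \<forall>j\<in>G - {k}. n \<noteq> j \<longrightarrow> y n \<le> x j \<or> y j \<le> x n"
    using Suc.hyps(1)[of "G - {k}" X'] Suc.prems(1) by blast
  have "m k < s k" using m(2)[OF k(1) s(1)[OF k(1)]] s(2)[OF k(1)] by simp
  then show ?case
    using xy disj m(1)[OF k(1)] s(1)[OF k(1)] unfolding X'_def
    by (intro exI[of _ "x(k := m k)"] exI[of _ "y(k := s k)"]) auto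
qed

text \<open>If no cylinder were stable, successive refinements would strictly enlarge the set, and
  their limit would inherit every stage and thus have an infinite set.\<close>

lemma ex_stable_cylinder:
  fixes T :: "(nat \<Rightarrow> 'a) \<Rightarrow> nat set"
  assumes fin: "\<And>c. finite (T c)" and T: "\<And>n. finitary (\<lambda>c. n \<in> T c)"
  shows "\<exists>c m. \<forall>d. agree m c d \<longrightarrow> T d = T c"
proof (rule ccontr)
  assume "\<not> ?thesis"
  then have unstable: "\<exists>d. agree m c d \<and> T d \<noteq> T c" for c m by blast
  have grow: "\<exists>m. \<forall>d. agree m c d \<longrightarrow> T c \<subseteq> T d" for c
  proof -
    have "finitary (\<lambda>d. \<forall>n\<in>T c. n \<in> T d)" by (rule finitary_ball[OF fin T])
    from finitaryD[OF this, of c] show ?thesis by (auto simp: subset_iff)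
  qed
  \<comment> \<open>The length \<open>m\<close> is to secure all of \<open>T c\<close>, so that
    passing to a member of the cylinder can only gain elements.\<close>
  define Q where "Q c m \<longleftrightarrow> (\<forall>d. agree m c d \<longrightarrow> T c \<subseteq> T d)" for c m
  define E where "E = (\<lambda>(c, m) (d, k). agree m c d \<and> m < k \<and> T c \<subset> T d)"
  have "\<exists>F. \<forall>n. (case F n of (c, m) \<Rightarrow> Q c m) \<and> E (F n) (F (Suc n))"
  proof (rule dependent_nat_choice)
    show "\<exists>F. case F of (c, m) \<Rightarrow> Q c m" using grow by (auto simp: Q_def)
  next
    fix F :: "(nat \<Rightarrow> 'a) \<times> nat" and n :: nat
    assume F: "case F of (c, m) \<Rightarrow> Q c m"
    obtain c m where cm: "F = (c, m)" by force
    obtain d where d: "agree m c d" "T d \<noteq> T c" using unstable by blast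
    obtain k where k: "Q d k" using grow by (auto simp: Q_def)
    have "Q d (max k (Suc m))" using k agree_mono[of "max k (Suc m)" d _ k] by (simp add: Q_def)
    moreover have "E F (d, max k (Suc m))" using F d by (auto simp: E_def cm Q_def)
    ultimately show "\<exists>F'. (case F' of (c, m) \<Rightarrow> Q c m) \<and> E F F'" by blast
  qed
  then obtain F where F: "\<And>n. (case F n of (c, m) \<Rightarrow> Q c m) \<and> E (F n) (F (Suc n))" by blast
  define C where "C n = fst (F n)" for n
  define M where "M n = snd (F n)" for n
  have Q: "Q (C n) (M n)" and E: "agree (M n) (C n) (C (Suc n))" "M n < M (Suc n)"
    "T (C n) \<subset> T (C (Suc n))" for n
    using F[of n] by (auto simp: C_def M_def E_def split: prod.splits)
  have "strict_mono M" using E(2) by (simp add: strict_mono_Suc_iff)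
  have later: "agree (M n) (C n) (C (n + j))" for n j
  proof (induction j)
    case (Suc j)
    have "agree (M n) (C (n + j)) (C (Suc (n + j)))"
      by (rule agree_mono[OF E(1)]) (simp add: \<open>strict_mono M\<close> strict_mono_less_eq)
    then show ?case using Suc agree_trans by fastforce
  qed simp
  \<comment> \<open>Diagonal limit: the lengths increase strictly, so \<open>i < M (Suc i)\<close>
    and coordinate \<open>i\<close> is fixed from stage \<open>Suc i\<close> on.\<close>
  define c where "c i = C (Suc i) i" for i
  have "agree (M n) (C n) c" for n
    unfolding agree_def
  proof (intro allI impI)
    fix i assume i: "i < M n"
    have i': "i < M (Suc i)" by (meson Suc_le_lessD \<open>strict_mono M\<close> strict_mono_imp_increasing)
    show "C n i = c i"
    proof (cases "n \<le> Suc i")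
      case True
      then show ?thesis using later[of n "Suc i - n"] i by (simp add: agree_def c_def)
    next
      case False
      then show ?thesis using later[of "Suc i" "n - Suc i"] i' by (simp add: agree_def c_def)
    qed
  qed
  then have "T (C n) \<subseteq> T c" for n using Q by (auto simp: Q_def)
  then have "card (T (C n)) \<le> card (T c)" for n using fin card_mono by blast
  moreover have "n \<le> card (T (C n))" for n
  proof (induction n)
    case (Suc n)
    then show ?case using psubset_card_mono[OF fin E(3)] by (meson Suc_leI le_less_trans)
  qed simp
  ultimately show False by (meson Suc_n_not_le_n le_trans)
qed

text \<open>Each of the three alternatives prevents \<open>S c n\<close> from being a monochromatic
  copy of the rationals, since such a copy is infinite and dense.\<close>

lemma ex_bad_colouring:
  fixes f :: "nat \<Rightarrow> 'b::linorder" and T :: "(nat \<Rightarrow> bool) \<Rightarrow> nat set"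
    and S :: "(nat \<Rightarrow> bool) \<Rightarrow> nat \<Rightarrow> nat set"
  assumes "inj f" and fin: "\<And>c. finite (T c)" and T: "\<And>n. finitary (\<lambda>c. n \<in> T c)"
    and S: "\<And>n x. finitary (\<lambda>c. x \<in> S c n)"
  shows "\<exists>c. \<forall>n\<in>T c. finite (S c n) \<or> (\<exists>x\<in>S c n. \<exists>y\<in>S c n. c x \<noteq> c y) \<or>
    (\<exists>x\<in>S c n. \<exists>y\<in>S c n. f x < f y \<and> finite {z \<in> S c n. f x < f z \<and> f z < f y})"
proof -
  obtain c0 m0 where stable: "\<And>d. agree m0 c0 d \<Longrightarrow> T d = T c0"
    using ex_stable_cylinder[OF fin T] by blast
  define F where "F = T c0"
  have "finite F" by (simp add: F_def fin)
  \<comment> \<open>One point more than \<open>card F\<close>, because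
    \<open>disjoint_intervals\<close> needs strictly more points than there are sets. The finite
    witness \<open>X\<close> lets an infinite \<open>S c n\<close> qualify, whose
    \<open>card\<close> would be 0.\<close>
  define good where "good c n \<longleftrightarrow> (\<exists>X. finite X \<and> card X = Suc (card F) \<and> (\<forall>x\<in>X. x \<in> S c n))" for c n
  define G where "G c = {n \<in> F. good c n}" for c
  \<comment> \<open>A maximum exists on the cylinder because all these counts are bounded by
    \<open>card F\<close>.\<close>
  have "\<exists>c. agree m0 c0 c \<and> (\<forall>d. agree m0 c0 d \<longrightarrow> card (G d) \<le> card (G c))"
    using \<open>finite F\<close>
    by (intro ex_has_greatest_nat[of _ c0 _ "Suc (card F)"])
      (auto simp: G_def less_Suc_eq_le intro!: card_mono)
  then obtain c where c: "agree m0 c0 c"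
    and max: "\<And>d. agree m0 c0 d \<Longrightarrow> card (G d) \<le> card (G c)" by blast
  have "\<forall>n\<in>G c. \<exists>X. finite X \<and> card X = Suc (card F) \<and> X \<subseteq> S c n"
    by (auto simp: G_def good_def subset_iff)
  then obtain X where X: "\<And>n. n \<in> G c \<Longrightarrow> finite (X n) \<and> card (X n) = Suc (card F) \<and> X n \<subseteq> S c n"
    by metis
  have "finite (G c)" using \<open>finite F\<close> by (simp add: G_def)
  have "finitary (\<lambda>d. \<forall>n\<in>G c. \<forall>x\<in>X n. x \<in> S d n)"
    by (intro finitary_ball S) (use \<open>finite (G c)\<close> X in auto)
  moreover have "\<forall>n\<in>G c. \<forall>x\<in>X n. x \<in> S c n" using X by blast
  ultimately have "\<exists>m. \<forall>d. agree m c d \<longrightarrow> (\<forall>n\<in>G c. \<forall>x\<in>X n. x \<in> S d n)" by (rule finitaryD)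
  then obtain m1 where m1: "\<And>d n. agree m1 c d \<Longrightarrow> n \<in> G c \<Longrightarrow> X n \<subseteq> S d n"
    by (auto simp: subset_iff)
  have "card (G c) \<le> card F" using \<open>finite F\<close> by (auto simp: G_def intro: card_mono)
  then have "finite (f ` X n) \<and> card (G c) < card (f ` X n)" if "n \<in> G c" for n
    using X[OF that] \<open>inj f\<close> by (simp add: card_image inj_on_subset)
  from disjoint_intervals[where X = "\<lambda>n. f ` X n", OF \<open>finite (G c)\<close> this] obtain a b
    where ab: "\<forall>n\<in>G c. a n \<in> f ` X n \<and> b n \<in> f ` X n \<and> a n < b n"
      and disj: "\<forall>n\<in>G c. \<forall>k\<in>G c. n \<noteq> k \<longrightarrow> b n \<le> a k \<or> b k \<le> a n" by blast
  from ab have "\<forall>n\<in>G c. \<exists>x y. x \<in> X n \<and> y \<in> X n \<and> f x = a n \<and> f y = b n" by (metis imageE)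
  then obtain x y where xy: "\<And>n. n \<in> G c \<Longrightarrow> x n \<in> X n \<and> y n \<in> X n \<and> f (x n) = a n \<and> f (y n) = b n"
    by metis
  \<comment> \<open>A prefix of this length secures the value of \<open>T\<close>, the sets
    \<open>X n\<close> and the colours of all left end points.\<close>
  define m where "m = Max (insert (max m0 m1) ((\<lambda>n. Suc (x n)) ` G c))"
  have m: "max m0 m1 \<le> m" "\<And>n. n \<in> G c \<Longrightarrow> x n < m"
    using \<open>finite (G c)\<close> Max_ge[of "insert (max m0 m1) ((\<lambda>n. Suc (x n)) ` G c)"]
    unfolding m_def by (blast, simp add: Suc_le_eq[symmetric])
  \<comment> \<open>Past the prefix, a point inside an interval gets the colour opposite to that of
    the left end point; points outside all intervals get the default \<open>False\<close>.\<close>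
  define d where "d i \<longleftrightarrow> (if i < m then c i else \<exists>n\<in>G c. a n < f i \<and> f i < b n \<and> \<not> c (x n))" for i
  have opposite: "d i = (\<not> c (x n))" if "n \<in> G c" "a n < f i" "f i < b n" "m \<le> i" for n i
  proof -
    \<comment> \<open>Disjointness leaves only one interval that can contain
      \<open>f i\<close>.\<close>
    have unique: "k = n" if "k \<in> G c" "a k < f i" "f i < b k" for k
      using disj that \<open>n \<in> G c\<close> \<open>a n < f i\<close> \<open>f i < b n\<close> by force
    have "(\<exists>k\<in>G c. a k < f i \<and> f i < b k \<and> \<not> c (x k)) \<longleftrightarrow> \<not> c (x n)"
    proof
      assume "\<exists>k\<in>G c. a k < f i \<and> f i < b k \<and> \<not> c (x k)"
      then obtain k where k: "k \<in> G c" "a k < f i" "f i < b k" "\<not> c (x k)" by blast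
      then show "\<not> c (x n)" using unique[OF k(1-3)] by simp
    qed (use that in blast)
    then show ?thesis using that(4) by (simp add: d_def)
  qed
  have "agree m c d" by (simp add: agree_def d_def)
  then have d: "agree m0 c d" "agree m1 c d" using m(1) agree_mono by auto
  then have d0: "agree m0 c0 d" using c agree_trans by blast
  \<comment> \<open>The witnesses \<open>X n\<close> survive the recolouring; maximality then
    excludes any newly good \<open>n\<close>.\<close>
  have "G c \<subseteq> G d"
  proof
    fix n assume n: "n \<in> G c"
    then have "good d n" unfolding good_def using X[OF n] m1[OF d(2) n] by blast
    then show "n \<in> G d" using n by (simp add: G_def)
  qed
  moreover have "finite (G d)" using \<open>finite F\<close> by (simp add: G_def)
  ultimately have "G d = G c" using card_seteq max[OF d0] by blast
  have "finite (S d n) \<or> (\<exists>x\<in>S d n. \<exists>y\<in>S d n. d x \<noteq> d y) \<or>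
    (\<exists>x\<in>S d n. \<exists>y\<in>S d n. f x < f y \<and> finite {z \<in> S d n. f x < f z \<and> f z < f y})"
    if "n \<in> T d" for n
  proof (cases "n \<in> G c")
    case False
    then have "\<not> good d n"
      using that stable[OF d0] \<open>G d = G c\<close> by (auto simp: G_def F_def)
    then have "finite (S d n)"
      unfolding good_def by (meson infinite_arbitrarily_large subsetD)
    then show ?thesis ..
  next
    case True
    have S: "x n \<in> S d n" "y n \<in> S d n" and "f (x n) < f (y n)"
      using xy[OF True] m1[OF d(2) True] ab True by auto
    \<comment> \<open>A monochromatic \<open>S d n\<close> has no point of the interval past the
      prefix, where the colour differs from that of \<open>x n\<close>.\<close>
    moreover have "finite {z \<in> S d n. f (x n) < f z \<and> f z < f (y n)}"
      if mono: "\<forall>x\<in>S d n. \<forall>y\<in>S d n. d x = d y"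
    proof (rule finite_subset)
      have "z < m" if z: "z \<in> S d n" "f (x n) < f z" "f z < f (y n)" for z
      proof (rule ccontr)
        assume "\<not> z < m"
        then have "d z = (\<not> c (x n))" using opposite[OF True] z xy[OF True] by simp
        moreover have "d (x n) = c (x n)" using m(2)[OF True] by (simp add: d_def)
        ultimately show False using mono z(1) S(1) by metis
      qed
      then show "{z \<in> S d n. f (x n) < f z \<and> f z < f (y n)} \<subseteq> {..<m}" by auto
    qed simp
    ultimately show ?thesis by blast
  qed
  then have bad: "\<forall>n\<in>T d. finite (S d n) \<or> (\<exists>x\<in>S d n. \<exists>y\<in>S d n. d x \<noteq> d y) \<or>
    (\<exists>x\<in>S d n. \<exists>y\<in>S d n. f x < f y \<and> finite {z \<in> S d n. f x < f z \<and> f z < f y})" ..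
  show ?thesis by (rule exI[of _ d]) (rule bad)
qed

section \<open>Instances and reductions\<close>

lemma join_inject: "p \<oplus> q = p' \<oplus> q' \<longleftrightarrow> p = p' \<and> q = q'"
proof
  assume eq: "p \<oplus> q = p' \<oplus> q'"
  have "p n = p' n" "q n = q' n" for n
    using fun_cong[OF eq, of "2 * n"] fun_cong[OF eq, of "Suc (2 * n)"] by (simp_all add: join_def)
  then show "p = p' \<and> q = q'" by blast
qed simp

lemma char_fun_inject: "char_fun A = char_fun B \<longleftrightarrow> A = B"
  by (auto simp: char_fun_def fun_eq_iff)

text \<open>With domain \<open>UNIV\<close> no colour is overwritten by 0, so the code determines
  the colouring. This matters because \<open>Ind_Q2\<close> admits every instance that has the given
  code.\<close>

lemma instance_code_UNIV_inject:
  assumes "instance_code UNIV R c = instance_code A R' c'"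
  shows "A = UNIV \<and> R' = R \<and> c' = c"
proof -
  have "A = UNIV" "prod_encode ` R = prod_encode ` R'"
    and c: "(\<lambda>n. if n \<in> UNIV then c n else 0) = (\<lambda>n. if n \<in> A then c' n else 0)"
    using assms unfolding instance_code_def join_inject char_fun_inject by auto
  moreover from this have "R = R'" by (metis inj_image_eq_iff inj_prod_encode)
  ultimately show ?thesis by simp
qed

definition colouring_code :: "(nat \<Rightarrow> rat) \<Rightarrow> (nat \<Rightarrow> bool) \<Rightarrow> baire" where
  "colouring_code f c = instance_code UNIV {(x, y). f x < f y} (\<lambda>n. of_bool (c n))"

lemma local_map_colouring_code: "local_map (colouring_code f)"
  unfolding local_map_def
proof (intro allI)
  fix i v
  show "finitary (\<lambda>c. colouring_code f c i = v)"
    using finitary_nth[of "\<lambda>b. of_bool b = v" "i div 2"]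
    by (cases "even i")
      (simp_all add: colouring_code_def instance_code_def join_def finitary_const)
qed

lemma Ind_Q2_colouring_code:
  assumes "bij f"
  shows "s \<in> Ind_Q2 (colouring_code f c) \<longleftrightarrow> (\<exists>H. s = char_fun H \<and>
    (\<forall>x\<in>H. \<forall>y\<in>H. c x = c y) \<and> iso_rat H ({(x, y). f x < f y} \<inter> H \<times> H))"
    (is "_ \<longleftrightarrow> (\<exists>H. ?P H)")
proof
  assume "s \<in> Ind_Q2 (colouring_code f c)"
  then obtain H A R c' i where *: "s = char_fun H" "colouring_code f c = instance_code A R c'"
    "\<forall>x\<in>H. c' x = i" "iso_rat H (R \<inter> H \<times> H)"
    unfolding Ind_Q2_def by blast
  have eq: "A = UNIV \<and> R = {(x, y). f x < f y} \<and> c' = (\<lambda>n. of_bool (c n))"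
    using *(2) unfolding colouring_code_def by (rule instance_code_UNIV_inject)
  have mono: "\<forall>x\<in>H. \<forall>y\<in>H. c x = c y" using *(3) eq by (metis of_bool_eq_iff)
  have "iso_rat H ({(x, y). f x < f y} \<inter> H \<times> H)" using *(4) eq by simp
  with *(1) mono show "\<exists>H. ?P H" by blast
next
  assume "\<exists>H. ?P H"
  then obtain H where H: "s = char_fun H" "\<forall>x\<in>H. \<forall>y\<in>H. c x = c y"
    "iso_rat H ({(x, y). f x < f y} \<inter> H \<times> H)"
    by (elim exE conjE)
  show "s \<in> Ind_Q2 (colouring_code f c)"
    unfolding Ind_Q2_def mem_Collect_eq
  proof (intro exI conjI)
    show "s = char_fun H" by (rule H(1))
    show "colouring_code f c = instance_code UNIV {(x, y). f x < f y} (\<lambda>n. of_bool (c n))"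
      by (rule colouring_code_def)
    show "rat_presentation UNIV {(x, y). f x < f y}"
      using assms by (auto simp: rat_presentation_def iso_rat_def)
    \<comment> \<open>The witness for the common colour is the colour of a chosen element; for empty
      \<open>H\<close> the claim is vacuous.\<close>
    show "\<forall>x\<in>H. of_bool (c x) = (of_bool (c (SOME x. x \<in> H)) :: nat)"
    proof
      fix x assume "x \<in> H"
      then have "c x = c (SOME x. x \<in> H)" using H(2) someI[of "\<lambda>x. x \<in> H" x] by blast
      then show "of_bool (c x) = (of_bool (c (SOME x. x \<in> H)) :: nat)" by (rule arg_cong)
    qed
    show "iso_rat H ({(x, y). f x < f y} \<inter> H \<times> H)" by (rule H(3))
  qed auto
qed

lemma colouring_code_in_pdom:
  assumes "bij f"
  shows "colouring_code f c \<in> pdom Ind_Q2"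
proof -
  obtain H k where H: "\<forall>x\<in>H. c x = k" "iso_rat H ({(x, y). f x < f y} \<inter> H \<times> H)"
    using rat_indivisible[OF assms, of c] by (elim exE conjE)
  have "char_fun H \<in> Ind_Q2 (colouring_code f c)"
    unfolding Ind_Q2_colouring_code[OF assms] using H by (intro exI[of _ H]) simp
  then show ?thesis by (auto simp: pdom_def)
qed

theorem theorem4p8:
  fixes P :: problem
  assumes "pointwise_ce_traceable P"
  shows "\<not> Ind_Q2 \<le>\<^sub>W P"
proof
  assume "Ind_Q2 \<le>\<^sub>W P"
  then obtain \<Delta>1 \<Psi>1 where 1: "\<forall>p\<in>pdom Ind_Q2. \<exists>r. functional_value \<Delta>1 p r \<and> r \<in> pdom P \<and>
      (\<forall>q\<in>P r. \<exists>s. functional_value \<Psi>1 (p \<oplus> q) s \<and> s \<in> Ind_Q2 p)"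
    unfolding weihrauch_le_def by blast
  obtain Q \<Gamma> where "P \<le>\<^sub>W as_problem Q"
    and \<Gamma>: "\<forall>q\<in>pdom Q. \<exists>e. computes q \<Gamma> 0 e \<and> finite (W q e) \<and> Q q \<inter> W q e \<noteq> {}"
    using assms unfolding pointwise_ce_traceable_def weihrauch_equiv_def by blast
  then obtain \<Delta>2 \<Psi>2 where 2: "\<forall>p\<in>pdom P. \<exists>r. functional_value \<Delta>2 p r \<and> r \<in> pdom (as_problem Q) \<and>
      (\<forall>q\<in>as_problem Q r. \<exists>s. functional_value \<Psi>2 (p \<oplus> q) s \<and> s \<in> P p)"
    unfolding weihrauch_le_def by blast
  define f :: "nat \<Rightarrow> rat" where "f = from_nat_into UNIV"
  have "bij f" unfolding f_def by (simp add: bij_betw_from_nat_into infinite_UNIV_char_0)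
  let ?p = "colouring_code f"
  have "\<forall>c. \<exists>r. functional_value \<Delta>1 (?p c) r \<and> r \<in> pdom P \<and>
      (\<forall>q\<in>P r. \<exists>s. functional_value \<Psi>1 (?p c \<oplus> q) s \<and> s \<in> Ind_Q2 (?p c))"
    using 1 colouring_code_in_pdom[OF \<open>bij f\<close>] by blast
  then obtain r1 where r1: "\<And>c. functional_value \<Delta>1 (?p c) (r1 c)" "\<And>c. r1 c \<in> pdom P"
    "\<And>c q. q \<in> P (r1 c) \<Longrightarrow> \<exists>s. functional_value \<Psi>1 (?p c \<oplus> q) s \<and> s \<in> Ind_Q2 (?p c)"
    by metis
  have "\<forall>c. \<exists>r. functional_value \<Delta>2 (r1 c) r \<and> r \<in> pdom (as_problem Q) \<and>
      (\<forall>q\<in>as_problem Q r. \<exists>s. functional_value \<Psi>2 (r1 c \<oplus> q) s \<and> s \<in> P (r1 c))"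
    using 2 r1(2) by blast
  then obtain r2 where r2: "\<And>c. functional_value \<Delta>2 (r1 c) (r2 c)" "\<And>c. r2 c \<in> pdom (as_problem Q)"
    "\<And>c q. q \<in> as_problem Q (r2 c) \<Longrightarrow> \<exists>s. functional_value \<Psi>2 (r1 c \<oplus> q) s \<and> s \<in> P (r1 c)"
    by metis
  have "r2 c \<in> pdom Q" for c using r2(2)[of c] by (auto simp: pdom_def as_problem_def)
  then have "\<forall>c. \<exists>e. computes (r2 c) \<Gamma> 0 e \<and> finite (W (r2 c) e) \<and> Q (r2 c) \<inter> W (r2 c) e \<noteq> {}"
    using \<Gamma> by blast
  then obtain e where e: "\<And>c. computes (r2 c) \<Gamma> 0 (e c)" "\<And>c. finite (W (r2 c) (e c))"
    "\<And>c. Q (r2 c) \<inter> W (r2 c) (e c) \<noteq> {}"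
    by metis
  \<comment> \<open>A functional that is total on a continuous family of oracles has continuous
    values, so both intermediate instances depend continuously on the colouring.\<close>
  have loc1: "local_map r1"
    by (rule local_map_functional_value[OF local_map_colouring_code r1(1)])
  have loc2: "local_map r2" by (rule local_map_functional_value[OF loc1 r2(1)])
  define T where "T c = W (r2 c) (e c)" for c
  have "computes (r2 c) \<Gamma> 0 i \<longleftrightarrow> i = e c" for i c
    using e(1)[of c] computes_deterministic by metis
  \<comment> \<open>Determinism allows the index \<open>e c\<close> to be replaced by an existential
    quantifier over programs, which exhibits membership as a union of open conditions.\<close>
  then have T_iff: "n \<in> T c \<longleftrightarrow> (\<exists>g y. computes (r2 c) \<Gamma> 0 (index g) \<and> computes (r2 c) g n y)" for n c
    by (simp add: T_def W_def)
  have T: "finitary (\<lambda>c. n \<in> T c)" for n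
    unfolding T_iff
    by (intro finitary_ex finitary_conj finitary_local_map[OF loc2 finitary_computes])
  text \<open>
    \<open>\<Psi>2\<close> may be partial on the oracle given by a wrong \<open>n\<close>, so the intermediate oracle for \<open>\<Psi>1\<close> is
    approximated by finite pieces.
  \<close>
  define S where "S c n = {x. \<exists>m t. (\<forall>i\<in>{..<m}. computes (r1 c \<oplus> (\<lambda>_. n)) \<Psi>2 i (t i)) \<and>
    (\<forall>p. agree m (?p c) p \<longrightarrow> (\<forall>t'. agree m t t' \<longrightarrow> computes (p \<oplus> t') \<Psi>1 x 1))}" for c n
  \<comment> \<open>Quantifying over a whole cylinder around \<open>?p c\<close> makes the second
    condition open by \<open>finitary_cylinder\<close>.\<close>
  have S: "finitary (\<lambda>c. x \<in> S c n)" for n x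
    unfolding S_def mem_Collect_eq
    by (intro finitary_ex finitary_conj finitary_ball finite_lessThan
        finitary_local_map[OF local_map_join_const[OF loc1] finitary_computes]
        finitary_local_map[OF local_map_colouring_code finitary_cylinder])
  have "finite (T c)" for c by (simp add: T_def e(2))
  from ex_bad_colouring[OF bij_is_inj[OF \<open>bij f\<close>] this T S]
  obtain c where c: "\<forall>n\<in>T c. finite (S c n) \<or> (\<exists>x\<in>S c n. \<exists>y\<in>S c n. c x \<noteq> c y) \<or>
      (\<exists>x\<in>S c n. \<exists>y\<in>S c n. f x < f y \<and> finite {z \<in> S c n. f x < f z \<and> f z < f y})" by (rule exE)
  obtain n where n: "n \<in> Q (r2 c)" "n \<in> T c" using e(3)[of c] unfolding T_def by blast
  then have "(\<lambda>_. n) \<in> as_problem Q (r2 c)" by (simp add: as_problem_def)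
  from r2(3)[OF this]
  obtain t where t: "functional_value \<Psi>2 (r1 c \<oplus> (\<lambda>_. n)) t" "t \<in> P (r1 c)" by (elim exE conjE)
  obtain H where H: "functional_value \<Psi>1 (?p c \<oplus> t) (char_fun H)"
    "\<forall>x\<in>H. \<forall>y\<in>H. c x = c y" "iso_rat H ({(x, y). f x < f y} \<inter> H \<times> H)"
    using r1(3)[OF t(2)]
    unfolding Ind_Q2_colouring_code[OF \<open>bij f\<close>] by (elim exE conjE) (simp only:)
  \<comment> \<open>For this correct \<open>n\<close>, \<open>\<Psi>2\<close> is total with value
    \<open>t\<close>, so the finite pieces are exactly prefixes of \<open>t\<close>; the use
    principle for \<open>\<Psi>1\<close> gives the inclusion of \<open>H\<close>.\<close>
  have "S c n = H"
  proof (intro set_eqI iffI)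
    fix x assume "x \<in> S c n"
    then obtain m u where u: "\<forall>i\<in>{..<m}. computes (r1 c \<oplus> (\<lambda>_. n)) \<Psi>2 i (u i)"
      and u': "\<forall>p. agree m (?p c) p \<longrightarrow> (\<forall>t'. agree m u t' \<longrightarrow> computes (p \<oplus> t') \<Psi>1 x 1)"
      unfolding S_def mem_Collect_eq by (elim exE conjE)
    have "agree m u t" using u by (simp add: agree_def functional_value_iff[OF t(1), symmetric])
    then have "computes (?p c \<oplus> t) \<Psi>1 x 1" using u' by simp
    then have "char_fun H x = 1" by (simp only: functional_value_iff[OF H(1)])
    then show "x \<in> H" by (cases "x \<in> H") (simp_all add: char_fun_def)
  next
    fix x assume "x \<in> H"
    then have "computes (?p c \<oplus> t) \<Psi>1 x 1"
      by (simp add: functional_value_iff[OF H(1), symmetric] char_fun_def)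
    from finitaryD[OF finitary_computes, OF this]
    obtain m where m: "\<forall>q. agree m (?p c \<oplus> t) q \<longrightarrow> computes q \<Psi>1 x 1" ..
    have "\<forall>i\<in>{..<m}. computes (r1 c \<oplus> (\<lambda>_. n)) \<Psi>2 i (t i)"
      using t(1) by (simp add: functional_value_def)
    moreover have "\<forall>p. agree m (?p c) p \<longrightarrow> (\<forall>t'. agree m t t' \<longrightarrow> computes (p \<oplus> t') \<Psi>1 x 1)"
      using m by (simp add: agree_join)
    ultimately show "x \<in> S c n" unfolding S_def by blast
  qed
  with bspec[OF c n(2)] have "finite H \<or> (\<exists>x\<in>H. \<exists>y\<in>H. c x \<noteq> c y) \<or>
      (\<exists>x\<in>H. \<exists>y\<in>H. f x < f y \<and> finite {z \<in> H. f x < f z \<and> f z < f y})"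
    by (simp only:)
  then show False
    using H(2) iso_rat_infinite[OF H(3)] iso_rat_infinite_interval[OF H(3)] by blast
qed

end
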